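(* Let $r,m,n\ge 1$ be integers. Let $p_1,\dots,p_r$, $g_1,\dots,g_m$ and $q$ be real polynomials on $\mathbb{R}^n$ such that all $p_j$, all $g_i$ and $-q$ are SOS-convex, and such that $p_j(x)\ge 0$ (for all $j$) and $q(x)>0$ for all $x\in\mathcal F:=\{x\in\mathbb{R}^n : g_i(x)\le 0,\ i=1,\dots,m\}\neq\emptyset$. Let $d$ be the smallest even number such that $d\ge\max\{\deg q,\ \max_j\deg p_j,\ \max_i\deg g_i\}$. Consider $$(\mathcal P)\quad \inf_{x\in\mathcal F}\ \max_{1\le j\le r}\frac{p_j(x)}{q(x)}$$ and $$(\mathcal D)\quad \sup\Big\{\mu : \sum_{j=1}^r\delta_jp_j+\sum_{i=1}^m\lambda_ig_i-\mu q\in\Sigma^2_d,\ \delta\in\Delta,\ \lambda\in\mathbb{R}^m_+,\ \mu\in\mathbb{R}\Big\}.$$ If the Slater condition $\{x\in\mathbb{R}^n : g_i(x)<0,\ i=1,\dots,m\}\neq\emptyset$ holds, then $\inf(\mathcal P)=\max(\mathcal D)$; that is, the optimal values are equal and the supremum in $(\mathcal D)$ is attained.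
   Context: $\mathbb{R}^k_+$ denotes the set of vectors in $\mathbb{R}^k$ with nonnegative coordinates, and $\Delta:=\{\delta\in\mathbb{R}^r_+ : \sum_{j=1}^r\delta_j=1\}$. A real polynomial $f$ on $\mathbb{R}^n$ is a sum of squares if it is a finite sum of squares of real polynomials; $\Sigma^2_d$ is the set of sum of squares real polynomials on $\mathbb{R}^n$ of degree at most $d$. A real polynomial $f$ on $\mathbb{R}^n$ is SOS-convex if its Hessian is an SOS-matrix polynomial, i.e. $\nabla^2 f(x)=H(x)H(x)^T$ for some $s\in\mathbb{N}$ and some matrix polynomial $H\in\mathbb{R}[x]^{n\times s}$. *)

theory Defs
  imports "HOL-Analysis.Analysis"
begin

text \<open>A real polynomial on \<open>real ^ 'n\<close> is a function satisfying
  \<^const>\<open>real_polynomial_function\<close>; over the reals, polynomials and polynomial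
  functions correspond bijectively.\<close>

definition monomial_value :: "('n::finite \<Rightarrow> nat) \<Rightarrow> real ^ 'n \<Rightarrow> real" where
  "monomial_value \<alpha> x = (\<Prod>i\<in>UNIV. x $ i ^ \<alpha> i)"

text \<open>Exponent vectors \<open>\<alpha>\<close> are grouped by their total degree \<open>\<Sum>i. \<alpha> i\<close>; the index set of the
  sum is finite (\<open>finite_exponents\<close> below).\<close>

definition poly_degree_le :: "nat \<Rightarrow> (real ^ 'n \<Rightarrow> real) \<Rightarrow> bool" where
  "poly_degree_le k f \<longleftrightarrow>
     (\<exists>c. \<forall>x. f x = (\<Sum>\<alpha> \<in> {\<alpha>. sum \<alpha> UNIV \<le> k}. c \<alpha> * monomial_value \<alpha> x))"

text \<open>Total degree; the zero polynomial has degree \<open>0\<close>. It is meaningful exactly for polynomial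
  functions, see \<open>real_polynomial_function_iff_degree_le\<close>.\<close>

definition poly_degree :: "(real ^ 'n \<Rightarrow> real) \<Rightarrow> nat" where
  "poly_degree f = (LEAST k. poly_degree_le k f)"

definition is_sos :: "(real ^ 'n \<Rightarrow> real) \<Rightarrow> bool" where
  "is_sos f \<longleftrightarrow>
     (\<exists>(s::nat) h. (\<forall>k<s. real_polynomial_function (h k)) \<and> (\<forall>x. f x = (\<Sum>k<s. (h k x)\<^sup>2)))"

definition Sigma2 :: "nat \<Rightarrow> (real ^ 'n \<Rightarrow> real) set" where
  "Sigma2 d = {f. is_sos f \<and> poly_degree f \<le> d}"

definition partial_derivative :: "'n \<Rightarrow> (real ^ 'n \<Rightarrow> real) \<Rightarrow> real ^ 'n \<Rightarrow> real" where
  "partial_derivative i f x = frechet_derivative f (at x) (axis i 1)"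

definition hessian :: "(real ^ 'n \<Rightarrow> real) \<Rightarrow> real ^ 'n \<Rightarrow> real ^ 'n ^ 'n" where
  "hessian f x = (\<chi> i j. partial_derivative i (partial_derivative j f) x)"

text \<open>The number \<open>s\<close> of columns of the matrix polynomial \<open>H\<close> is existentially quantified, so \<open>H\<close>
  is given by its entries \<open>H i k\<close> with \<open>k < s\<close>, and \<open>M x = H x ** transpose (H x)\<close> is written
  entrywise.\<close>

definition sos_matrix_polynomial :: "(real ^ 'n \<Rightarrow> real ^ 'n ^ 'n) \<Rightarrow> bool" where
  "sos_matrix_polynomial M \<longleftrightarrow>
     (\<exists>(s::nat) H. (\<forall>i. \<forall>k<s. real_polynomial_function (H i k)) \<and>
        (\<forall>x i j. M x $ i $ j = (\<Sum>k<s. H i k x * H j k x)))"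

definition sos_convex :: "(real ^ 'n \<Rightarrow> real) \<Rightarrow> bool" where
  "sos_convex f \<longleftrightarrow> real_polynomial_function f \<and> sos_matrix_polynomial (hessian f)"

definition simplex_weights :: "(real ^ 'r) set" where
  "simplex_weights = {\<delta>. (\<forall>j. 0 \<le> \<delta> $ j) \<and> (\<Sum>j\<in>UNIV. \<delta> $ j) = 1}"

definition feasible_set :: "('m \<Rightarrow> real ^ 'n \<Rightarrow> real) \<Rightarrow> (real ^ 'n) set" where
  "feasible_set g = {x. \<forall>i. g i x \<le> 0}"

definition even_degree_bound ::
  "('r::finite \<Rightarrow> real ^ 'n \<Rightarrow> real) \<Rightarrow> ('m::finite \<Rightarrow> real ^ 'n \<Rightarrow> real) \<Rightarrow> (real ^ 'n \<Rightarrow> real) \<Rightarrow> nat" where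
  "even_degree_bound p g q =
     (LEAST d. even d \<and>
        Max ({poly_degree q} \<union> range (\<lambda>j. poly_degree (p j)) \<union> range (\<lambda>i. poly_degree (g i))) \<le> d)"

text \<open>Optimal values are taken in \<^typ>\<open>ereal\<close>, so that infimum and supremum always exist with
  their usual meaning.\<close>

definition primal_value ::
  "('r::finite \<Rightarrow> real ^ 'n \<Rightarrow> real) \<Rightarrow> ('m::finite \<Rightarrow> real ^ 'n \<Rightarrow> real) \<Rightarrow> (real ^ 'n \<Rightarrow> real) \<Rightarrow> ereal" where
  "primal_value p g q = (INF x \<in> feasible_set g. ereal (Max (range (\<lambda>j. p j x / q x))))"

definition dual_feasible_values ::
  "('r::finite \<Rightarrow> real ^ 'n \<Rightarrow> real) \<Rightarrow> ('m::finite \<Rightarrow> real ^ 'n \<Rightarrow> real) \<Rightarrow> (real ^ 'n \<Rightarrow> real) \<Rightarrow> real set" where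
  "dual_feasible_values p g q =
     {\<mu>. \<exists>(\<delta> :: real ^ 'r) (l :: real ^ 'm).
        \<delta> \<in> simplex_weights \<and> (\<forall>i. 0 \<le> l $ i) \<and>
        (\<lambda>x. (\<Sum>j\<in>UNIV. \<delta> $ j * p j x) + (\<Sum>i\<in>UNIV. l $ i * g i x) - \<mu> * q x)
          \<in> Sigma2 (even_degree_bound p g q)}"

definition dual_value ::
  "('r::finite \<Rightarrow> real ^ 'n \<Rightarrow> real) \<Rightarrow> ('m::finite \<Rightarrow> real ^ 'n \<Rightarrow> real) \<Rightarrow> (real ^ 'n \<Rightarrow> real) \<Rightarrow> ereal" where
  "dual_value p g q = (SUP \<mu> \<in> dual_feasible_values p g q. ereal \<mu>)"


lemma finite_exponents: "finite {\<alpha> :: 'n::finite \<Rightarrow> nat. sum \<alpha> UNIV \<le> k}"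
proof (rule finite_subset)
  show "{\<alpha> :: 'n \<Rightarrow> nat. sum \<alpha> UNIV \<le> k} \<subseteq> PiE UNIV (\<lambda>_. {..k})"
  proof
    fix \<alpha> :: "'n \<Rightarrow> nat" assume a: "\<alpha> \<in> {\<alpha>. sum \<alpha> UNIV \<le> k}"
    have "\<alpha> i \<le> k" for i
      using member_le_sum[of i UNIV \<alpha>] a by fastforce
    then show "\<alpha> \<in> PiE UNIV (\<lambda>_. {..k})" by auto
  qed
  show "finite (PiE (UNIV :: 'n set) (\<lambda>_. {..k}))" by (intro finite_PiE) auto
qed

lemma poly_degree_le_finite_sum:
  fixes f :: "real ^ 'n \<Rightarrow> real" and E :: "'a \<Rightarrow> 'n \<Rightarrow> nat"
  assumes "finite A" and "\<And>a. a \<in> A \<Longrightarrow> sum (E a) UNIV \<le> k"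
    and f: "\<And>x. f x = (\<Sum>a\<in>A. c a * monomial_value (E a) x)"
  shows "poly_degree_le k f"
  unfolding poly_degree_le_def
proof (intro exI allI)
  fix x
  have "f x = (\<Sum>\<alpha>\<in>{\<alpha>. sum \<alpha> UNIV \<le> k}. \<Sum>a\<in>{a\<in>A. E a = \<alpha>}. c a * monomial_value (E a) x)"
    unfolding f using assms by (intro sum.group[symmetric] finite_exponents) auto
  also have "\<dots> = (\<Sum>\<alpha>\<in>{\<alpha>. sum \<alpha> UNIV \<le> k}. (\<Sum>a\<in>{a\<in>A. E a = \<alpha>}. c a) * monomial_value \<alpha> x)"
    by (intro sum.cong refl) (simp add: sum_distrib_right)
  finally show "f x = (\<Sum>\<alpha>\<in>{\<alpha>. sum \<alpha> UNIV \<le> k}. (\<Sum>a\<in>{a\<in>A. E a = \<alpha>}. c a) * monomial_value \<alpha> x)" .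
qed

lemma poly_degree_le_mono:
  assumes "poly_degree_le k f" "k \<le> l"
  shows "poly_degree_le l f"
proof -
  obtain c where "\<And>x. f x = (\<Sum>\<alpha>\<in>{\<alpha>. sum \<alpha> UNIV \<le> k}. c \<alpha> * monomial_value \<alpha> x)"
    using assms by (auto simp: poly_degree_le_def)
  then show ?thesis
    using assms(2) by (intro poly_degree_le_finite_sum[OF finite_exponents]) auto
qed

lemma poly_degree_le_const: "poly_degree_le 0 (\<lambda>x. c)"
  by (rule poly_degree_le_finite_sum[of "{()}" "\<lambda>_ _. 0" 0 _ "\<lambda>_. c"])
     (auto simp: monomial_value_def)

lemma poly_degree_le_add:
  assumes "poly_degree_le k f" "poly_degree_le k g"
  shows "poly_degree_le k (\<lambda>x. f x + g x)"
proof -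
  obtain c where c: "\<And>x. f x = (\<Sum>\<alpha>\<in>{\<alpha>. sum \<alpha> UNIV \<le> k}. c \<alpha> * monomial_value \<alpha> x)"
    using assms by (auto simp: poly_degree_le_def)
  obtain e where e: "\<And>x. g x = (\<Sum>\<alpha>\<in>{\<alpha>. sum \<alpha> UNIV \<le> k}. e \<alpha> * monomial_value \<alpha> x)"
    using assms by (auto simp: poly_degree_le_def)
  show ?thesis unfolding poly_degree_le_def
    by (intro exI[of _ "\<lambda>\<alpha>. c \<alpha> + e \<alpha>"]) (simp add: c e algebra_simps sum.distrib)
qed

lemma monomial_value_add: "monomial_value (\<lambda>i. \<alpha> i + \<beta> i) x = monomial_value \<alpha> x * monomial_value \<beta> x"
  by (simp add: monomial_value_def power_add prod.distrib)

lemma poly_degree_le_mult: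
  fixes f g :: "real ^ 'n \<Rightarrow> real"
  assumes "poly_degree_le k f" "poly_degree_le l g"
  shows "poly_degree_le (k + l) (\<lambda>x. f x * g x)"
proof -
  obtain c where c: "\<And>x. f x = (\<Sum>\<alpha>\<in>{\<alpha>. sum \<alpha> UNIV \<le> k}. c \<alpha> * monomial_value \<alpha> x)"
    using assms by (auto simp: poly_degree_le_def)
  obtain e where e: "\<And>x. g x = (\<Sum>\<alpha>\<in>{\<alpha>. sum \<alpha> UNIV \<le> l}. e \<alpha> * monomial_value \<alpha> x)"
    using assms by (auto simp: poly_degree_le_def)
  show ?thesis
  proof (rule poly_degree_le_finite_sum)
    show "finite ({\<alpha> :: 'n \<Rightarrow> nat. sum \<alpha> UNIV \<le> k} \<times> {\<beta> :: 'n \<Rightarrow> nat. sum \<beta> UNIV \<le> l})"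
      by (intro finite_cartesian_product finite_exponents)
    show "sum ((\<lambda>\<gamma> i. fst \<gamma> i + snd \<gamma> i) \<gamma>) UNIV \<le> k + l"
      if "\<gamma> \<in> {\<alpha> :: 'n \<Rightarrow> nat. sum \<alpha> UNIV \<le> k} \<times> {\<beta> :: 'n \<Rightarrow> nat. sum \<beta> UNIV \<le> l}" for \<gamma>
      using that by (cases \<gamma>) (simp add: sum.distrib add_mono)
    show "f x * g x = (\<Sum>\<gamma>\<in>{\<alpha>. sum \<alpha> UNIV \<le> k} \<times> {\<beta>. sum \<beta> UNIV \<le> l}.
        (c (fst \<gamma>) * e (snd \<gamma>)) * monomial_value ((\<lambda>\<gamma> i. fst \<gamma> i + snd \<gamma> i) \<gamma>) x)" for x
      unfolding c e sum_product sum.cartesian_product monomial_value_add split_def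
      by (intro sum.cong refl) (simp only: mult_ac)
  qed
qed

lemma poly_degree_le_linear:
  fixes f :: "real ^ 'n \<Rightarrow> real"
  assumes "bounded_linear f"
  shows "poly_degree_le 1 f"
proof -
  have m: "monomial_value (\<lambda>j. if j = i then 1 else 0) x = x $ i" for i and x :: "real ^ 'n"
  proof -
    have "monomial_value (\<lambda>j. if j = i then 1 else 0) x = (\<Prod>j\<in>UNIV. if j = i then x $ j else 1)"
      unfolding monomial_value_def by (intro prod.cong) auto
    then show ?thesis by simp
  qed
  have f: "f x = (\<Sum>i\<in>UNIV. f (axis i 1) * monomial_value (\<lambda>j. if j = i then 1 else 0) x)" for x
  proof -
    have "f x = f (\<Sum>i\<in>UNIV. x $ i *\<^sub>R axis i 1)"
      using basis_expansion[of x] by (simp only: scalar_mult_eq_scaleR)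
    also have "\<dots> = (\<Sum>i\<in>UNIV. f (axis i 1) * x $ i)"
      using bounded_linear.linear[OF assms]
      by (simp add: linear_sum linear_cmul mult.commute)
    finally show ?thesis by (simp only: m)
  qed
  show ?thesis
  proof (rule poly_degree_le_finite_sum[OF finite _ f])
    show "(\<Sum>j\<in>UNIV. if j = i then 1 else 0) \<le> (1::nat)" for i :: 'n by simp
  qed
qed

lemma real_polynomial_function_iff_degree_le:
  fixes f :: "real ^ 'n \<Rightarrow> real"
  shows "real_polynomial_function f \<longleftrightarrow> (\<exists>k. poly_degree_le k f)"
proof
  show "\<exists>k. poly_degree_le k f" if "real_polynomial_function f"
    using that
  proof induction
    case (add f g)
    then obtain k l where "poly_degree_le k f" "poly_degree_le l g" by blast
    then have "poly_degree_le (max k l) f" "poly_degree_le (max k l) g"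
      by (auto intro: poly_degree_le_mono)
    then show ?case using poly_degree_le_add by blast
  next
    case (linear f)
    then show ?case using poly_degree_le_linear by blast
  next
    case (const c)
    show ?case using poly_degree_le_const[of c] by blast
  next
    case (mult f g)
    then show ?case using poly_degree_le_mult by blast
  qed
next
  assume "\<exists>k. poly_degree_le k f"
  then obtain k c where
    "f = (\<lambda>x. \<Sum>\<alpha>\<in>{\<alpha>. sum \<alpha> UNIV \<le> k}. c \<alpha> * monomial_value \<alpha> x)"
    by (auto simp: poly_degree_le_def)
  then show "real_polynomial_function f"
    unfolding monomial_value_def
    by (simp only:)
       (rule real_polynomial_function_sum[OF finite_exponents],
        rule real_polynomial_function.intros(4)[OF real_polynomial_function.intros(2)],
        rule real_polynomial_function_prod[OF finite],
        rule real_polynomial_function_power,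
        rule real_polynomial_function.intros(1)[OF bounded_linear_vec_nth])
qed

end

theory Submission
  imports Defs
begin

text \<open>With \<open>V\<close> the primal value, \<open>V \<ge> 0\<close> makes each \<open>p\<^sub>j - V q\<close> SOS-convex, and separation
  under the Slater condition yields multipliers for which the Lagrangian
  \<open>L = \<Sum>\<^sub>j \<delta>\<^sub>j (p\<^sub>j - V q) + \<Sum>\<^sub>i \<lambda>\<^sub>i g\<^sub>i\<close> is nonnegative on the whole space. A convex
  polynomial that is bounded below attains its infimum, say \<open>L\<close> at \<open>z\<close>. Along the segment from
  \<open>z\<close> to \<open>x\<close> the second derivative of an SOS-convex polynomial is a sum of squares of polynomials
  in the segment parameter \<open>s\<close> whose coefficients are polynomials in \<open>x\<close>; integrating twice over
  \<open>s\<close> turns each square into a positive semidefinite form in these coefficients. Hence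
  \<open>L - L z\<close> is a sum of squares, and so is \<open>L\<close>.\<close>

section \<open>Closure properties of sums of squares\<close>

lemma is_sos_nonneg: "is_sos f \<Longrightarrow> 0 \<le> f x"
  by (auto simp: is_sos_def intro!: sum_nonneg)

lemma is_sos_zero: "is_sos (\<lambda>x. 0)"
  unfolding is_sos_def by (intro exI[of _ 0]) simp

lemma is_sos_add_square:
  assumes "is_sos f" and "real_polynomial_function h"
  shows "is_sos (\<lambda>x. f x + (h x)\<^sup>2)"
proof -
  obtain s :: nat and k where k: "\<forall>i<s. real_polynomial_function (k i)"
      "\<forall>x. f x = (\<Sum>i<s. (k i x)\<^sup>2)"
    using assms(1) unfolding is_sos_def by blast
  show ?thesis
    unfolding is_sos_def
  proof (intro exI conjI allI impI)
    show "real_polynomial_function ((k(s := h)) i)" if "i < Suc s" for i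
      using that k assms(2) by auto
    show "f x + (h x)\<^sup>2 = (\<Sum>i<Suc s. ((k(s := h)) i x)\<^sup>2)" for x
      by (simp add: k)
  qed
qed

lemma is_sos_square: "real_polynomial_function h \<Longrightarrow> is_sos (\<lambda>x. (h x)\<^sup>2)"
  using is_sos_add_square[OF is_sos_zero] by simp

lemma is_sos_const: "0 \<le> c \<Longrightarrow> is_sos (\<lambda>x. c)"
  using is_sos_square[of "\<lambda>x. sqrt c"] by (simp add: real_polynomial_function.intros)

lemma is_sos_add:
  assumes "is_sos f" and "is_sos g"
  shows "is_sos (\<lambda>x. f x + g x)"
proof -
  obtain s :: nat and k where k: "\<forall>i<s. real_polynomial_function (k i)"
      "\<forall>x. g x = (\<Sum>i<s. (k i x)\<^sup>2)"
    using assms(2) unfolding is_sos_def by blast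
  have "is_sos (\<lambda>x. f x + (\<Sum>i<t. (k i x)\<^sup>2))" if "t \<le> s" for t :: nat
    using that
  proof (induction t)
    case 0
    then show ?case using assms(1) by simp
  next
    case (Suc t)
    then show ?case
      using is_sos_add_square[of "\<lambda>x. f x + (\<Sum>i<t. (k i x)\<^sup>2)" "k t"] k(1) by (simp add: add.assoc)
  qed
  then show ?thesis using k(2) by simp
qed

lemma is_sos_scale:
  assumes "is_sos f" and "0 \<le> c"
  shows "is_sos (\<lambda>x. c * f x)"
proof -
  obtain s :: nat and k where k: "\<forall>i<s. real_polynomial_function (k i)"
      "\<forall>x. f x = (\<Sum>i<s. (k i x)\<^sup>2)"
    using assms(1) unfolding is_sos_def by blast
  show ?thesis
    unfolding is_sos_def
  proof (intro exI conjI allI impI)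
    show "real_polynomial_function (\<lambda>x. sqrt c * k i x)" if "i < s" for i
      using k(1) that by (intro real_polynomial_function.intros(2,4)) auto
    show "c * f x = (\<Sum>i<s. (sqrt c * k i x)\<^sup>2)" for x
      using assms(2) by (simp add: k power_mult_distrib sum_distrib_left)
  qed
qed

lemma is_sos_sum:
  assumes "finite A" and "\<And>a. a \<in> A \<Longrightarrow> is_sos (f a)"
  shows "is_sos (\<lambda>x. \<Sum>a\<in>A. f a x)"
  using assms by (induction A rule: finite_induct) (auto simp: is_sos_zero is_sos_add)

text \<open>Completing the square in one variable at a time diagonalises the form.\<close>

lemma is_sos_psd_form:
  fixes M :: "'a \<Rightarrow> 'a \<Rightarrow> real"
  assumes "finite A"
    and "\<And>a b. M a b = M b a"
    and "\<And>y :: 'a \<Rightarrow> real. 0 \<le> (\<Sum>a\<in>A. \<Sum>b\<in>A. M a b * y a * y b)"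
    and "\<And>a. a \<in> A \<Longrightarrow> real_polynomial_function (c a)"
  shows "is_sos (\<lambda>x. \<Sum>a\<in>A. \<Sum>b\<in>A. M a b * c a x * c b x)"
  using assms
proof (induction A arbitrary: M rule: finite_induct)
  case empty
  show ?case by (simp add: is_sos_zero)
next
  case (insert t A)
  note sym = insert.prems(1) and psd = insert.prems(2) and pol = insert.prems(3)
  have expand: "(\<Sum>a\<in>insert t A. \<Sum>b\<in>insert t A. M a b * y a * y b) =
      M t t * (y t)\<^sup>2 + 2 * y t * (\<Sum>b\<in>A. M t b * y b) + (\<Sum>a\<in>A. \<Sum>b\<in>A. M a b * y a * y b)"
    for y :: "'a \<Rightarrow> real"
  proof -
    have "(\<Sum>a\<in>A. M a t * y a * y t) = y t * (\<Sum>b\<in>A. M t b * y b)"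
      by (subst sum_distrib_left) (intro sum.cong refl, simp add: sym[of _ t])
    moreover have "(\<Sum>b\<in>A. M t b * y t * y b) = y t * (\<Sum>b\<in>A. M t b * y b)"
      by (subst sum_distrib_left) (intro sum.cong refl, simp)
    ultimately show ?thesis
      using insert.hyps by (simp add: sum.distrib power2_eq_square algebra_simps)
  qed
  have upd: "(\<Sum>b\<in>A. M t b * (y(t := v)) b) = (\<Sum>b\<in>A. M t b * y b)"
      "(\<Sum>a\<in>A. \<Sum>b\<in>A. M a b * (y(t := v)) a * (y(t := v)) b) = (\<Sum>a\<in>A. \<Sum>b\<in>A. M a b * y a * y b)"
    for y v
    using insert.hyps by (auto intro!: sum.cong)
  \<comment> \<open>The coordinate at \<open>t\<close> is set to a free value \<open>v\<close>,
    which leaves a quadratic in \<open>v\<close> that is nonnegative for every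
    \<open>v\<close>.\<close>
  have psd': "0 \<le> M t t * v\<^sup>2 + 2 * v * (\<Sum>b\<in>A. M t b * y b) + (\<Sum>a\<in>A. \<Sum>b\<in>A. M a b * y a * y b)"
    for y v
    using psd[of "y(t := v)"] unfolding expand upd by simp
  have diag: "0 \<le> M t t"
    using psd'[of 1 "\<lambda>_. 0"] by simp
  \<comment> \<open>Schur complement of the entry \<open>M t t\<close>. If that entry is
    \<open>0\<close>, division by zero yields \<open>0\<close>, so \<open>N\<close> is
    \<open>M\<close>, which is the right form in that case.\<close>
  define N where "N a b = M a b - M t a * M t b / M t t" for a b
  have N: "(\<Sum>a\<in>A. \<Sum>b\<in>A. N a b * y a * y b) =
      (\<Sum>a\<in>A. \<Sum>b\<in>A. M a b * y a * y b) - (\<Sum>b\<in>A. M t b * y b)\<^sup>2 / M t t" for y :: "'a \<Rightarrow> real"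
    unfolding N_def power2_eq_square sum_product sum_divide_distrib
    by (simp add: algebra_simps sum_subtractf)
  have N_psd: "0 \<le> (\<Sum>a\<in>A. \<Sum>b\<in>A. N a b * y a * y b)" for y :: "'a \<Rightarrow> real"
  proof (cases "M t t = 0")
    case True
    then show ?thesis using psd'[of 0 y] N[of y] by simp
  next
    case False
    \<comment> \<open>\<open>- S / M t t\<close> is the vertex of the quadratic in \<open>v\<close>;
      the bound there is positivity of the Schur complement.\<close>
    have "0 \<le> M t t * (- S / M t t)\<^sup>2 + 2 * (- S / M t t) * S + Q
        \<Longrightarrow> 0 \<le> Q - S\<^sup>2 / M t t" for S Q :: real
      using False by (simp add: power2_eq_square)
    then show ?thesis unfolding N using psd' by blast
  qed
  have IH: "is_sos (\<lambda>x. \<Sum>a\<in>A. \<Sum>b\<in>A. N a b * c a x * c b x)"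
    using N_psd pol by (intro insert.IH) (auto simp: N_def sym mult.commute)
  have lin: "real_polynomial_function (\<lambda>x. \<Sum>b\<in>A. M t b * c b x)"
    using pol insert.hyps
    by (intro real_polynomial_function_sum real_polynomial_function.intros(2,4)) auto
  have "(\<Sum>a\<in>insert t A. \<Sum>b\<in>insert t A. M a b * c a x * c b x) =
      (\<Sum>a\<in>A. \<Sum>b\<in>A. N a b * c a x * c b x)
        + (sqrt (M t t) * (c t x + (\<Sum>b\<in>A. M t b * c b x) / M t t))\<^sup>2" for x
  proof (cases "M t t = 0")
    case True
    define S where "S = (\<Sum>b\<in>A. M t b * c b x)"
    define Q where "Q = (\<Sum>a\<in>A. \<Sum>b\<in>A. M a b * c a x * c b x)"
    \<comment> \<open>Without a quadratic term the bound is affine in \<open>v\<close>, so its slope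
      must vanish; the \<open>v\<close> chosen for the contradiction below makes the expression
      \<open>-1\<close>.\<close>
    have lin_nonneg: "0 \<le> 2 * v * S + Q" for v
      using psd'[of v "\<lambda>b. c b x"] True by (simp add: S_def Q_def)
    have "S = 0"
    proof (rule ccontr)
      assume "S \<noteq> 0"
      then show False using lin_nonneg[of "- (Q + 1) / (2 * S)"] by (simp add: field_simps)
    qed
    then show ?thesis
      using True expand[of "\<lambda>a. c a x"] N[of "\<lambda>a. c a x"] by (simp add: S_def)
  next
    case False
    have "m * u\<^sup>2 + 2 * u * S + Q = Q - S\<^sup>2 / m + m * (u + S / m)\<^sup>2"
      if "m \<noteq> 0" for m u S Q :: real
      using that by (simp add: field_simps power2_eq_square)
    then show ?thesis
      using False diag expand[of "\<lambda>a. c a x"] N[of "\<lambda>a. c a x"]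
      by (simp add: power_mult_distrib)
  qed
  moreover have "real_polynomial_function (\<lambda>x. sqrt (M t t) * (c t x + (\<Sum>b\<in>A. M t b * c b x) / M t t))"
    using pol lin
    by (intro real_polynomial_function.intros(2-4) real_polynomial_function_divide) auto
  ultimately show ?case
    using is_sos_add_square[OF IH] by simp
qed

section \<open>Polynomials along a segment and squares integrated twice\<close>

text \<open>Linear functions restrict to polynomials of degree at most one in \<open>s\<close>, and
  the property survives sums and products. The bound \<open>N\<close> is uniform in
  \<open>x\<close>, so one fixed number of coefficient functions suffices later.\<close>

lemma real_polynomial_function_along_rays:
  assumes "real_polynomial_function h"
  shows "\<exists>(P :: 'a::real_normed_vector \<Rightarrow> real poly) N.
      (\<forall>b. real_polynomial_function (\<lambda>x. coeff (P x) b)) \<and> (\<forall>x. degree (P x) \<le> N) \<and>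
      (\<forall>x s. h (a + s *\<^sub>R (x - a)) = poly (P x) s)"
  using assms
proof (induction h rule: real_polynomial_function.induct)
  case (linear f)
  interpret bounded_linear f by (fact linear.hyps)
  show ?case
  proof (intro exI[of _ "\<lambda>x. [:f a, f (x - a):]"] exI[of _ 1] conjI allI)
    have "real_polynomial_function (\<lambda>x. f x - f a)"
      by (intro real_polynomial_function_diff real_polynomial_function.intros(1,2)) (fact linear.hyps)
    then have "real_polynomial_function (\<lambda>x. f (x - a))" by (simp add: diff)
    then show "real_polynomial_function (\<lambda>x. coeff [:f a, f (x - a):] b)" for b
      by (cases b; cases "b - 1") (auto simp: coeff_pCons intro: real_polynomial_function.intros)
  qed (auto simp: add scale)
next
  case (const c)
  show ?case
    by (intro exI[of _ "\<lambda>x. [:c:]"] exI[of _ 0] conjI allI)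
       (auto intro: real_polynomial_function.intros)
next
  case (add f g)
  then obtain P N Q K where *:
    "\<And>b. real_polynomial_function (\<lambda>x. coeff (P x) b)" "\<And>x. degree (P x) \<le> N"
    "\<And>x s. f (a + s *\<^sub>R (x - a)) = poly (P x) s"
    "\<And>b. real_polynomial_function (\<lambda>x. coeff (Q x) b)" "\<And>x. degree (Q x) \<le> K"
    "\<And>x s. g (a + s *\<^sub>R (x - a)) = poly (Q x) s"
    by blast
  show ?case
  proof (intro exI[of _ "\<lambda>x. P x + Q x"] exI[of _ "max N K"] conjI allI)
    show "degree (P x + Q x) \<le> max N K" for x
      using *(2)[of x] *(5)[of x] by (intro degree_add_le) auto
  qed (use * in \<open>auto intro: real_polynomial_function.intros\<close>)
next
  case (mult f g)
  then obtain P N Q K where *: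
    "\<And>b. real_polynomial_function (\<lambda>x. coeff (P x) b)" "\<And>x. degree (P x) \<le> N"
    "\<And>x s. f (a + s *\<^sub>R (x - a)) = poly (P x) s"
    "\<And>b. real_polynomial_function (\<lambda>x. coeff (Q x) b)" "\<And>x. degree (Q x) \<le> K"
    "\<And>x s. g (a + s *\<^sub>R (x - a)) = poly (Q x) s"
    by blast
  show ?case
  proof (intro exI[of _ "\<lambda>x. P x * Q x"] exI[of _ "N + K"] conjI allI)
    show "degree (P x * Q x) \<le> N + K" for x
      using degree_mult_le[of "P x" "Q x"] *(2)[of x] *(5)[of x] by linarith
    show "real_polynomial_function (\<lambda>x. coeff (P x * Q x) b)" for b
      unfolding coeff_mult using *
      by (intro real_polynomial_function_sum real_polynomial_function.intros(2,4)) auto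
  qed (use * in auto)
qed

text \<open>The mean value theorem for \<open>\<phi>\<close>, whose derivative is nondecreasing.
  Besides giving positivity of the Gram form, it serves with zero second derivative for a function
  and its negative, to obtain an equality.\<close>

lemma second_derivative_nonneg_imp_above_tangent:
  fixes \<phi> \<phi>' \<phi>'' :: "real \<Rightarrow> real"
  assumes "\<And>s. (\<phi> has_real_derivative \<phi>' s) (at s)"
    and "\<And>s. (\<phi>' has_real_derivative \<phi>'' s) (at s)"
    and "\<And>s. 0 \<le> \<phi>'' s"
  shows "\<phi> 0 + \<phi>' 0 \<le> \<phi> 1"
proof -
  have "\<phi>' 0 \<le> \<phi>' s" if "0 \<le> s" for s
    using assms(2,3) by (intro DERIV_nonneg_imp_nondecreasing[OF that]) blast
  moreover obtain z where "0 < z" "\<phi> 1 - \<phi> 0 = (1 - 0) * \<phi>' z"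
    using MVT2[of 0 1 \<phi> \<phi>'] assms(1) by auto
  ultimately have "\<phi>' 0 \<le> \<phi> 1 - \<phi> 0" by simp
  then show ?thesis by simp
qed

text \<open>The coefficients of the form are the double integrals of \<open>s ^ (a + b)\<close> over
  \<open>0 \<le> s \<le> t \<le> 1\<close>.\<close>

lemma square_double_antiderivative:
  fixes y :: "nat \<Rightarrow> real"
  obtains \<phi> \<phi>' where "\<And>s. (\<phi> has_real_derivative \<phi>' s) (at s)"
    and "\<And>s. (\<phi>' has_real_derivative (\<Sum>a\<le>N. y a * s ^ a)\<^sup>2) (at s)"
    and "\<phi> 0 = 0" and "\<phi>' 0 = 0"
    and "\<phi> 1 = (\<Sum>a\<le>N. \<Sum>b\<le>N. 1 / real ((a + b + 1) * (a + b + 2)) * y a * y b)"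
proof
  let ?\<phi> = "\<lambda>s. \<Sum>a\<le>N. \<Sum>b\<le>N. 1 / real ((a + b + 1) * (a + b + 2)) * y a * y b * s ^ (a + b + 2)"
  let ?\<phi>' = "\<lambda>s. \<Sum>a\<le>N. \<Sum>b\<le>N. 1 / real (a + b + 1) * y a * y b * s ^ (a + b + 1)"
  show "(?\<phi> has_real_derivative ?\<phi>' s) (at s)" for s
  proof (intro DERIV_sum DERIV_cong[OF DERIV_cmult[OF DERIV_pow]])
    have "1 / real (u * v) * c * e * (real v * w) = 1 / real u * c * e * w"
      if "v \<noteq> 0" for u v :: nat and c e w :: real
      using that by simp
    from this[of "a + b + 2" "a + b + 1" "y a" "y b" "s ^ (a + b + 1)" for a b]
    show "1 / real ((a + b + 1) * (a + b + 2)) * y a * y b *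
        (real (a + b + 2) * s ^ (a + b + 2 - Suc 0)) =
        1 / real (a + b + 1) * y a * y b * s ^ (a + b + 1)" for a b
      by simp
  qed
  show "(?\<phi>' has_real_derivative (\<Sum>a\<le>N. y a * s ^ a)\<^sup>2) (at s)" for s
    unfolding power2_eq_square sum_product
    by (intro DERIV_sum DERIV_cong[OF DERIV_cmult[OF DERIV_pow]])
       (simp add: field_simps power_add)
qed simp_all

text \<open>The form is the value at \<open>1\<close> of a function with zero value and slope at
  \<open>0\<close> whose second derivative is a square, so it lies above a zero tangent.\<close>

lemma gram_form_nonneg:
  fixes y :: "nat \<Rightarrow> real"
  shows "0 \<le> (\<Sum>a\<le>N. \<Sum>b\<le>N. 1 / real ((a + b + 1) * (a + b + 2)) * y a * y b)"
proof (rule square_double_antiderivative[of y N])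
  fix \<phi> \<phi>'
  assume "\<And>s. (\<phi> has_real_derivative \<phi>' s) (at s)"
    and "\<And>s. (\<phi>' has_real_derivative (\<Sum>a\<le>N. y a * s ^ a)\<^sup>2) (at s)"
    and *: "\<phi> 0 = 0" "\<phi>' 0 = 0"
      "\<phi> 1 = (\<Sum>a\<le>N. \<Sum>b\<le>N. 1 / real ((a + b + 1) * (a + b + 2)) * y a * y b)"
  then have "\<phi> 0 + \<phi>' 0 \<le> \<phi> 1"
    by (intro second_derivative_nonneg_imp_above_tangent[where \<phi>'' = "\<lambda>s. (\<Sum>a\<le>N. y a * s ^ a)\<^sup>2"]) simp_all
  then show ?thesis unfolding * by simp
qed

section \<open>Taylor remainders of SOS-convex polynomials\<close>

lemma real_polynomial_function_has_derivative:
  fixes f :: "'a::real_normed_vector \<Rightarrow> real"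
  assumes "real_polynomial_function f"
  shows "(f has_derivative frechet_derivative f (at x)) (at x)"
  using assms differentiable_at_real_polynomial_function frechet_derivative_works by blast

lemma real_polynomial_function_frechet_derivative:
  fixes f :: "'a::real_normed_vector \<Rightarrow> real"
  assumes "real_polynomial_function f"
  shows "real_polynomial_function (\<lambda>x. frechet_derivative f (at x) v)"
  using assms
proof (induction f rule: real_polynomial_function.induct)
  case (linear f)
  have "frechet_derivative f (at x) = f" for x
    using bounded_linear_imp_has_derivative[OF linear.hyps] by (rule frechet_derivative_at[symmetric])
  then show ?case by (simp add: real_polynomial_function.intros)
next
  case (const c)
  then show ?case by (simp add: real_polynomial_function.intros)
next
  case (add f g)
  note D = add.hyps[THEN real_polynomial_function_has_derivative]
  have "frechet_derivative (\<lambda>x. f x + g x) (at x) =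
      (\<lambda>v. frechet_derivative f (at x) v + frechet_derivative g (at x) v)" for x
    by (rule frechet_derivative_at[symmetric]) (rule has_derivative_add[OF D])
  then show ?case using add.IH by (simp add: real_polynomial_function.intros)
next
  case (mult f g)
  note D = mult.hyps[THEN real_polynomial_function_has_derivative]
  have "frechet_derivative (\<lambda>x. f x * g x) (at x) =
      (\<lambda>v. f x * frechet_derivative g (at x) v + frechet_derivative f (at x) v * g x)" for x
    by (rule frechet_derivative_at[symmetric]) (rule has_derivative_mult[OF D])
  then show ?case using mult by (simp add: real_polynomial_function.intros)
qed

lemma linear_eq_sum_axis:
  fixes l :: "real ^ 'n \<Rightarrow> real"
  assumes "linear l"
  shows "l v = (\<Sum>i\<in>UNIV. v $ i * l (axis i 1))"
proof -
  have "l v = l (\<Sum>i\<in>UNIV. v $ i *\<^sub>R axis i 1)"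
    using basis_expansion[of v] by (simp only: scalar_mult_eq_scaleR)
  then show ?thesis using assms by (simp add: linear_sum linear_cmul)
qed

lemma DERIV_along_line:
  fixes f :: "real ^ 'n \<Rightarrow> real"
  assumes "real_polynomial_function f"
  shows "((\<lambda>s. f (a + s *\<^sub>R v)) has_real_derivative
      (\<Sum>i\<in>UNIV. v $ i * partial_derivative i f (a + s *\<^sub>R v))) (at s)"
proof -
  let ?D = "frechet_derivative f (at (a + s *\<^sub>R v))"
  have D: "(f has_derivative ?D) (at (a + s *\<^sub>R v))"
    using assms by (rule real_polynomial_function_has_derivative)
  have "((\<lambda>s. a + s *\<^sub>R v) has_derivative (\<lambda>h. h *\<^sub>R v)) (at s)"
    by (auto intro!: derivative_eq_intros)
  from has_derivative_compose[OF this D]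
  have "((\<lambda>s. f (a + s *\<^sub>R v)) has_derivative (\<lambda>h. ?D (h *\<^sub>R v))) (at s)" .
  moreover have "?D (h *\<^sub>R v) = (\<Sum>i\<in>UNIV. v $ i * partial_derivative i f (a + s *\<^sub>R v)) * h" for h
    using linear_cmul[OF has_derivative_linear[OF D]] linear_eq_sum_axis[OF has_derivative_linear[OF D], of v]
    by (simp add: partial_derivative_def mult.commute)
  ultimately show ?thesis by (simp add: has_field_derivative_def)
qed

text \<open>Bridge from squares along a segment to sums of squares in its endpoint \<open>x\<close>.
  Collecting powers of the segment parameter leaves coefficients polynomial in \<open>x\<close>, and
  integrating the square twice gives the Gram form in them. \<open>R\<close> is one function of
  \<open>x\<close>, while the antiderivatives may depend on \<open>x\<close>.\<close>

lemma is_sos_square_double_antiderivative: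
  fixes h :: "'n::finite \<Rightarrow> real ^ 'n \<Rightarrow> real"
  assumes "\<And>i. real_polynomial_function (h i)"
  obtains R where "is_sos R"
    and "\<And>x. \<exists>\<phi> \<phi>'. (\<forall>s. (\<phi> has_real_derivative \<phi>' s) (at s)) \<and>
      (\<forall>s. (\<phi>' has_real_derivative (\<Sum>i\<in>UNIV. (x - a) $ i * h i (a + s *\<^sub>R (x - a)))\<^sup>2) (at s)) \<and>
      \<phi> 0 = 0 \<and> \<phi>' 0 = 0 \<and> \<phi> 1 = R x"
proof -
  have "\<forall>i. \<exists>P N. (\<forall>b. real_polynomial_function (\<lambda>x. coeff (P x) b)) \<and>
      (\<forall>x. degree (P x) \<le> N) \<and> (\<forall>x s. h i (a + s *\<^sub>R (x - a)) = poly (P x) s)"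
    using real_polynomial_function_along_rays[OF assms, of _ a] by blast
  then obtain P N where PN: "\<forall>i. (\<forall>b. real_polynomial_function (\<lambda>x. coeff (P i x) b)) \<and>
      (\<forall>x. degree (P i x) \<le> N i) \<and> (\<forall>x s. h i (a + s *\<^sub>R (x - a)) = poly (P i x) s)"
    unfolding choice_iff by blast
  then have P: "\<And>i b. real_polynomial_function (\<lambda>x. coeff (P i x) b)"
    and N: "\<And>i x. degree (P i x) \<le> N i"
    and h: "\<And>i x s. h i (a + s *\<^sub>R (x - a)) = poly (P i x) s"
    by blast+
  define K where "K = Max (range N)"
  have deg: "degree (P i x) \<le> K" for i x
    unfolding K_def by (rule order_trans[OF N[of i x] Max_ge]) auto
  define c where "c b x = (\<Sum>i\<in>UNIV. (x - a) $ i * coeff (P i x) b)" for b x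
  have c: "real_polynomial_function (c b)" for b
  proof -
    have "real_polynomial_function (\<lambda>x::real^'n. (x - a) $ i)" for i
      unfolding vector_minus_component
      by (intro real_polynomial_function_diff real_polynomial_function.intros(1,2) bounded_linear_vec_nth)
    then show ?thesis
      unfolding c_def using P
      by (intro real_polynomial_function_sum real_polynomial_function.intros(4)) auto
  qed
  have G: "(\<Sum>i\<in>UNIV. (x - a) $ i * h i (a + s *\<^sub>R (x - a))) = (\<Sum>b\<le>K. c b x * s ^ b)" for x s
  proof -
    have "poly (P i x) s = (\<Sum>b\<le>K. coeff (P i x) b * s ^ b)" for i
      proof -
      have "(\<Sum>b\<le>degree (P i x). coeff (P i x) b * s ^ b) = (\<Sum>b\<le>K. coeff (P i x) b * s ^ b)"
        using deg[of i x] by (intro sum.mono_neutral_left) (auto simp: coeff_eq_0)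
      then show ?thesis by (simp add: poly_altdef)
    qed
    then have "(\<Sum>i\<in>UNIV. (x - a) $ i * h i (a + s *\<^sub>R (x - a))) =
        (\<Sum>i\<in>UNIV. \<Sum>b\<le>K. (x - a) $ i * coeff (P i x) b * s ^ b)"
      by (simp add: h sum_distrib_left mult.assoc)
    then show ?thesis
      unfolding c_def sum_distrib_right by (subst (asm) sum.swap)
  qed
  let ?R = "\<lambda>x. \<Sum>i\<le>K. \<Sum>j\<le>K. 1 / real ((i + j + 1) * (i + j + 2)) * c i x * c j x"
  show thesis
  proof (rule that)
    show "is_sos ?R"
      by (rule is_sos_psd_form[where M = "\<lambda>i j. 1 / real ((i + j + 1) * (i + j + 2))"])
         (use c gram_form_nonneg in \<open>simp_all add: add.commute\<close>)
    show "\<exists>\<phi> \<phi>'. (\<forall>s. (\<phi> has_real_derivative \<phi>' s) (at s)) \<and>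
        (\<forall>s. (\<phi>' has_real_derivative (\<Sum>i\<in>UNIV. (x - a) $ i * h i (a + s *\<^sub>R (x - a)))\<^sup>2) (at s)) \<and>
        \<phi> 0 = 0 \<and> \<phi>' 0 = 0 \<and> \<phi> 1 = ?R x" for x
      unfolding G by (rule square_double_antiderivative[of "\<lambda>b. c b x" K]) blast
  qed
qed

text \<open>Along the segment from \<open>a\<close> to \<open>x\<close> the second derivative of
  \<open>f\<close> is the Hessian form in the direction \<open>x - a\<close>, to which each column
  of \<open>H\<close> contributes one square. Integrated twice, these squares add up to the
  remainder, since second derivative and initial data determine a function.\<close>

lemma sos_convex_taylor_remainder:
  fixes f :: "real ^ 'n \<Rightarrow> real"
  assumes "sos_convex f"
  shows "is_sos (\<lambda>x. f x - f a - frechet_derivative f (at a) (x - a))"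
proof -
  have f: "real_polynomial_function f" using assms by (simp add: sos_convex_def)
  have f': "real_polynomial_function (partial_derivative i f)" for i
    using real_polynomial_function_frechet_derivative[OF f, of "axis i 1"]
    by (simp add: partial_derivative_def[abs_def])
  obtain r :: nat and H where H: "\<forall>i. \<forall>k<r. real_polynomial_function (H i k)"
    "\<forall>x i j. hessian f x $ i $ j = (\<Sum>k<r. H i k x * H j k x)"
    using assms unfolding sos_convex_def sos_matrix_polynomial_def by blast
  define G where "G k x s = (\<Sum>i\<in>UNIV. (x - a) $ i * H i k (a + s *\<^sub>R (x - a)))" for k x s
  have "\<forall>k\<in>{..<r}. \<exists>R. is_sos R \<and> (\<forall>x. \<exists>\<phi> \<phi>'. (\<forall>s. (\<phi> has_real_derivative \<phi>' s) (at s)) \<and>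
      (\<forall>s. (\<phi>' has_real_derivative (G k x s)\<^sup>2) (at s)) \<and> \<phi> 0 = 0 \<and> \<phi>' 0 = 0 \<and> \<phi> 1 = R x)"
  proof
    fix k assume "k \<in> {..<r}"
    then have "\<And>i. real_polynomial_function (H i k)" using H(1) by simp
    then show "\<exists>R. is_sos R \<and> (\<forall>x. \<exists>\<phi> \<phi>'. (\<forall>s. (\<phi> has_real_derivative \<phi>' s) (at s)) \<and>
      (\<forall>s. (\<phi>' has_real_derivative (G k x s)\<^sup>2) (at s)) \<and> \<phi> 0 = 0 \<and> \<phi>' 0 = 0 \<and> \<phi> 1 = R x)"
      unfolding G_def
      by (rule is_sos_square_double_antiderivative[where h = "\<lambda>i. H i k" and a = a]) blast
  qed
  from bchoice[OF this] obtain R where R: "\<forall>k\<in>{..<r}. is_sos (R k) \<and>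
      (\<forall>x. \<exists>\<phi> \<phi>'. (\<forall>s. (\<phi> has_real_derivative \<phi>' s) (at s)) \<and>
      (\<forall>s. (\<phi>' has_real_derivative (G k x s)\<^sup>2) (at s)) \<and> \<phi> 0 = 0 \<and> \<phi>' 0 = 0 \<and> \<phi> 1 = R k x)"
    by blast
  have "f x - f a - frechet_derivative f (at a) (x - a) = (\<Sum>k<r. R k x)" for x
  proof -
    define v where "v = x - a"
    \<comment> \<open>The functions \<open>R k\<close> are already fixed; only the antiderivatives
      are chosen for this particular \<open>x\<close>.\<close>
    have "\<forall>k\<in>{..<r}. \<exists>\<phi> \<phi>'. (\<forall>s. (\<phi> has_real_derivative \<phi>' s) (at s)) \<and>
        (\<forall>s. (\<phi>' has_real_derivative (G k x s)\<^sup>2) (at s)) \<and> \<phi> 0 = 0 \<and> \<phi>' 0 = 0 \<and> \<phi> 1 = R k x"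
      using R by blast
    then obtain \<phi> \<phi>' where *: "\<forall>k\<in>{..<r}. (\<forall>s. (\<phi> k has_real_derivative \<phi>' k s) (at s)) \<and>
        (\<forall>s. (\<phi>' k has_real_derivative (G k x s)\<^sup>2) (at s)) \<and>
        \<phi> k 0 = 0 \<and> \<phi>' k 0 = 0 \<and> \<phi> k 1 = R k x"
      unfolding bchoice_iff by blast
    then have \<phi>: "\<And>k s. k < r \<Longrightarrow> (\<phi> k has_real_derivative \<phi>' k s) (at s)"
      "\<And>k s. k < r \<Longrightarrow> (\<phi>' k has_real_derivative (G k x s)\<^sup>2) (at s)"
      "\<And>k. k < r \<Longrightarrow> \<phi> k 0 = 0 \<and> \<phi>' k 0 = 0 \<and> \<phi> k 1 = R k x"
      by auto
    define F' where "F' s = (\<Sum>i\<in>UNIV. v $ i * partial_derivative i f (a + s *\<^sub>R v))" for s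
    have F: "((\<lambda>s. f (a + s *\<^sub>R v)) has_real_derivative F' s) (at s)" for s
      unfolding F'_def by (rule DERIV_along_line[OF f])
    have F': "(F' has_real_derivative (\<Sum>k<r. (G k x s)\<^sup>2)) (at s)" for s
    proof -
      have "(F' has_real_derivative (\<Sum>j\<in>UNIV. v $ j *
          (\<Sum>i\<in>UNIV. v $ i * partial_derivative i (partial_derivative j f) (a + s *\<^sub>R v)))) (at s)"
        unfolding F'_def by (intro DERIV_sum DERIV_cmult DERIV_along_line f')
      moreover have "partial_derivative i (partial_derivative j f) y = (\<Sum>k<r. H i k y * H j k y)" for i j y
        using H(2) by (simp add: hessian_def)
      \<comment> \<open>The Hessian form splits into one square per column: v^T H H^T v is the
        squared norm of H^T v.\<close>
      moreover have "(\<Sum>j\<in>UNIV. v $ j * (\<Sum>i\<in>UNIV. v $ i * (\<Sum>k<r. H i k y * H j k y))) =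
          (\<Sum>k<r. (\<Sum>i\<in>UNIV. v $ i * H i k y)\<^sup>2)" for y
      proof -
        have "(\<Sum>j\<in>UNIV. v $ j * (\<Sum>i\<in>UNIV. v $ i * (\<Sum>k<r. H i k y * H j k y))) =
            (\<Sum>j\<in>UNIV. \<Sum>i\<in>UNIV. \<Sum>k<r. v $ j * H j k y * (v $ i * H i k y))"
          by (simp add: sum_distrib_left mult_ac)
        also have "\<dots> = (\<Sum>j\<in>UNIV. \<Sum>k<r. \<Sum>i\<in>UNIV. v $ j * H j k y * (v $ i * H i k y))"
          by (intro sum.cong refl sum.swap)
        also have "\<dots> = (\<Sum>k<r. \<Sum>j\<in>UNIV. \<Sum>i\<in>UNIV. v $ j * H j k y * (v $ i * H i k y))"
          by (rule sum.swap)
        finally show ?thesis by (simp only: power2_eq_square sum_product)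
      qed
      ultimately show ?thesis by (simp add: G_def v_def)
    qed
    \<comment> \<open>Both terms of \<open>D\<close> have the same second derivative, so
      \<open>D\<close> is affine; the inequalities for \<open>D\<close> and \<open>- D\<close> below
      give \<open>D 1 = D 0 + D' 0\<close>, which is the claim.\<close>
    define D where "D s = f (a + s *\<^sub>R v) - (\<Sum>k<r. \<phi> k s)" for s
    define D' where "D' s = F' s - (\<Sum>k<r. \<phi>' k s)" for s
    have D: "(D has_real_derivative D' s) (at s)" for s
      unfolding D_def[abs_def] D'_def using F \<phi>(1) by (intro DERIV_diff DERIV_sum) auto
    have D': "(D' has_real_derivative 0) (at s)" for s
    proof -
      have "(D' has_real_derivative (\<Sum>k<r. (G k x s)\<^sup>2) - (\<Sum>k<r. (G k x s)\<^sup>2)) (at s)"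
        unfolding D'_def[abs_def] using F' \<phi>(2) by (intro DERIV_diff DERIV_sum) auto
      then show ?thesis by simp
    qed
    have "D 0 + D' 0 \<le> D 1"
      using D D' by (rule second_derivative_nonneg_imp_above_tangent) simp
    moreover have "(- D 0) + (- D' 0) \<le> - D 1"
      by (rule second_derivative_nonneg_imp_above_tangent[where \<phi> = "\<lambda>s. - D s" and \<phi>' = "\<lambda>s. - D' s" and \<phi>'' = "\<lambda>_. 0"])
         (use DERIV_minus[OF D] DERIV_minus[OF D'] in simp_all)
    moreover have "F' 0 = frechet_derivative f (at a) v"
      unfolding F'_def partial_derivative_def
      using linear_eq_sum_axis[OF has_derivative_linear[OF real_polynomial_function_has_derivative[OF f]], of a v]
      by simp
    ultimately show ?thesis
      using \<phi>(3) by (simp add: D_def D'_def v_def)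
  qed
  then show ?thesis using is_sos_sum[of "{..<r}" R] R by simp
qed

section \<open>Polynomials whose Taylor remainders are sums of squares\<close>

text \<open>Unlike \<open>sos_convex\<close>, this property passes to nonnegative combinations without a
  computation with Hessians.\<close>

definition sos_taylor_remainders :: "(real ^ 'n \<Rightarrow> real) \<Rightarrow> bool" where
  "sos_taylor_remainders f \<longleftrightarrow> real_polynomial_function f \<and>
     (\<forall>a. is_sos (\<lambda>x. f x - f a - frechet_derivative f (at a) (x - a)))"

lemma sos_convex_imp_sos_taylor_remainders: "sos_convex f \<Longrightarrow> sos_taylor_remainders f"
  unfolding sos_taylor_remainders_def using sos_convex_taylor_remainder sos_convex_def by blast

lemma sos_taylor_remainders_add:
  fixes f g :: "real ^ 'n \<Rightarrow> real"
  assumes "sos_taylor_remainders f" and "sos_taylor_remainders g"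
  shows "sos_taylor_remainders (\<lambda>x. f x + g x)"
  unfolding sos_taylor_remainders_def
proof (intro conjI allI)
  have f: "real_polynomial_function f" and g: "real_polynomial_function g"
    using assms by (simp_all add: sos_taylor_remainders_def)
  then show "real_polynomial_function (\<lambda>x. f x + g x)" by (rule real_polynomial_function.intros)
  fix a
  have "frechet_derivative (\<lambda>x. f x + g x) (at a) =
      (\<lambda>v. frechet_derivative f (at a) v + frechet_derivative g (at a) v)"
    using f g
    by (intro frechet_derivative_at[symmetric] has_derivative_add real_polynomial_function_has_derivative)
  moreover have "is_sos (\<lambda>x. (f x - f a - frechet_derivative f (at a) (x - a)) +
      (g x - g a - frechet_derivative g (at a) (x - a)))"
    using assms by (intro is_sos_add) (simp_all add: sos_taylor_remainders_def)
  ultimately show "is_sos (\<lambda>x. f x + g x - (f a + g a) - frechet_derivative (\<lambda>x. f x + g x) (at a) (x - a))"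
    by (simp add: algebra_simps)
qed

lemma sos_taylor_remainders_cmult:
  fixes f :: "real ^ 'n \<Rightarrow> real"
  assumes "sos_taylor_remainders f" and "0 \<le> c"
  shows "sos_taylor_remainders (\<lambda>x. c * f x)"
  unfolding sos_taylor_remainders_def
proof (intro conjI allI)
  have f: "real_polynomial_function f"
    using assms by (simp add: sos_taylor_remainders_def)
  then show "real_polynomial_function (\<lambda>x. c * f x)"
    by (intro real_polynomial_function.intros(2,4))
  fix a
  have "frechet_derivative (\<lambda>x. c * f x) (at a) = (\<lambda>v. c * frechet_derivative f (at a) v)"
    using f
    by (intro frechet_derivative_at[symmetric] has_derivative_mult_right real_polynomial_function_has_derivative)
  moreover have "is_sos (\<lambda>x. c * (f x - f a - frechet_derivative f (at a) (x - a)))"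
    using assms by (intro is_sos_scale) (simp_all add: sos_taylor_remainders_def)
  ultimately show "is_sos (\<lambda>x. c * f x - c * f a - frechet_derivative (\<lambda>x. c * f x) (at a) (x - a))"
    by (simp add: algebra_simps)
qed

lemma sos_taylor_remainders_zero: "sos_taylor_remainders (\<lambda>x. 0)"
  by (simp add: sos_taylor_remainders_def is_sos_zero real_polynomial_function.intros)

lemma sos_taylor_remainders_sum:
  assumes "finite A" and "\<And>a. a \<in> A \<Longrightarrow> sos_taylor_remainders (f a)"
  shows "sos_taylor_remainders (\<lambda>x. \<Sum>a\<in>A. f a x)"
  using assms
  by (induction A rule: finite_induct) (auto simp: sos_taylor_remainders_zero sos_taylor_remainders_add)

text \<open>Nonnegative remainders put \<open>f\<close> above each of its tangents. When the tangent
  bounds at the intermediate point \<open>z\<close> are weighted, the linear terms cancel.\<close>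

lemma sos_taylor_remainders_imp_convex_on:
  fixes f :: "real ^ 'n \<Rightarrow> real"
  assumes "sos_taylor_remainders f"
  shows "convex_on UNIV f"
proof (rule convex_onI)
  fix t :: real and x y :: "real ^ 'n"
  assume t: "0 < t" "t < 1"
  define z where "z = (1 - t) *\<^sub>R x + t *\<^sub>R y"
  define l where "l = frechet_derivative f (at z)"
  have f: "real_polynomial_function f" using assms by (simp add: sos_taylor_remainders_def)
  have l: "linear l"
    unfolding l_def using real_polynomial_function_has_derivative[OF f] by (rule has_derivative_linear)
  have "(1 - t) *\<^sub>R (x - z) + t *\<^sub>R (y - z) = 0"
    by (simp add: z_def algebra_simps)
  then have "l ((1 - t) *\<^sub>R (x - z) + t *\<^sub>R (y - z)) = 0"
    by (simp add: linear_0[OF l])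
  then have "(1 - t) * l (x - z) + t * l (y - z) = 0"
    by (simp add: linear_add[OF l] linear_cmul[OF l])
  moreover have "f z + l (w - z) \<le> f w" for w
  proof -
    have "is_sos (\<lambda>x. f x - f z - l (x - z))"
      using assms by (simp add: sos_taylor_remainders_def l_def)
    from is_sos_nonneg[OF this, of w] show ?thesis by simp
  qed
  then have "(1 - t) * (f z + l (x - z)) \<le> (1 - t) * f x" "t * (f z + l (y - z)) \<le> t * f y"
    using t by (auto intro!: mult_left_mono)
  ultimately show "f ((1 - t) *\<^sub>R x + t *\<^sub>R y) \<le> (1 - t) * f x + t * f y"
    unfolding z_def[symmetric] by (simp add: algebra_simps)
qed simp

section \<open>Attainment of the infimum by convex polynomials bounded below\<close>

text \<open>A nonzero coefficient of positive degree makes a polynomial in one variable unbounded at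
  infinity, so boundedness on the half-line leaves only the constant term. The conclusion covers
  negative \<open>t\<close> as well.\<close>

lemma real_polynomial_bounded_on_ray_const:
  assumes "real_polynomial_function f" and "\<And>t. 0 \<le> t \<Longrightarrow> \<bar>f t\<bar> \<le> B"
  shows "f t = f (0::real)"
proof -
  obtain a n where f: "f = (\<lambda>x. \<Sum>i\<le>n. a i * x ^ i)"
    using assms(1) real_polynomial_function_iff_sum by blast
  have "a k = 0" if k: "k \<le> n" "1 \<le> k" for k
  proof (rule ccontr)
    assume "a k \<noteq> 0"
    then have "eventually (\<lambda>z. B + 1 \<le> norm (\<Sum>i\<le>n. a i * z ^ i)) at_infinity"
      using k by (intro polyfun_extremal exI[of _ k]) auto
    then obtain b where b: "\<And>z. b \<le> norm z \<Longrightarrow> B + 1 \<le> \<bar>f z\<bar>"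
      by (auto simp: eventually_at_infinity f)
    show False using b[of "\<bar>b\<bar>"] assms(2)[of "\<bar>b\<bar>"] abs_ge_self[of b] by simp
  qed
  then have "f t = (\<Sum>i\<in>{0}. a i * t ^ i)" for t
    unfolding f by (intro sum.mono_neutral_right) (auto simp: Suc_le_eq)
  then show ?thesis by simp
qed

text \<open>Convexity passes the bound on the far points \<open>y n\<close> to points near
  \<open>x + s *\<^sub>R u\<close>, so \<open>f\<close> stays at most \<open>f x\<close> on the ray
  from \<open>x\<close> along \<open>u\<close>. Being bounded below too, the polynomial restriction
  is constant, even for negative \<open>t\<close>.\<close>

lemma convex_polynomial_constant_along_recession:
  fixes f :: "'a::real_normed_vector \<Rightarrow> real"
  assumes pol: "real_polynomial_function f" and conv: "convex_on UNIV f"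
    and lower: "\<And>x. m \<le> f x"
    and y: "\<And>n. f (y n) \<le> C" "filterlim (\<lambda>n. norm (y n)) at_top sequentially"
      "(\<lambda>n. y n /\<^sub>R norm (y n)) \<longlonglongrightarrow> u"
  shows "f (x + t *\<^sub>R u) = f x"
proof -
  have cont: "isCont f z" for z
    by (intro differentiable_imp_continuous_within differentiable_at_real_polynomial_function pol)
  have le: "f (x + s *\<^sub>R u) \<le> f x" if "0 \<le> s" for s
  proof -
    \<comment> \<open>The weight for which \<open>e n *\<^sub>R y n\<close> is \<open>s\<close>
      times the unit direction of \<open>y n\<close>; it tends to \<open>0\<close>, so the
      contribution \<open>e n * C\<close> disappears in the limit.\<close>
    define e where "e n = s / norm (y n)" for n
    have e: "e \<longlonglongrightarrow> 0"
      unfolding e_def using tendsto_divide_0[OF tendsto_const filterlim_at_top_imp_at_infinity[OF y(2)]] .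
    have "(\<lambda>n. (1 - e n) *\<^sub>R x + s *\<^sub>R (y n /\<^sub>R norm (y n))) \<longlonglongrightarrow> (1 - 0) *\<^sub>R x + s *\<^sub>R u"
      by (intro tendsto_intros e y(3))
    then have "(\<lambda>n. (1 - e n) *\<^sub>R x + e n *\<^sub>R y n) \<longlonglongrightarrow> x + s *\<^sub>R u"
      by (simp add: e_def divide_inverse)
    then have "(\<lambda>n. f ((1 - e n) *\<^sub>R x + e n *\<^sub>R y n)) \<longlonglongrightarrow> f (x + s *\<^sub>R u)"
      by (rule isCont_tendsto_compose[OF cont])
    moreover have "(\<lambda>n. (1 - e n) * f x + e n * C) \<longlonglongrightarrow> (1 - 0) * f x + 0 * C"
      by (intro tendsto_intros e)
    moreover have "eventually (\<lambda>n. f ((1 - e n) *\<^sub>R x + e n *\<^sub>R y n) \<le> (1 - e n) * f x + e n * C) sequentially"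
    proof -
      have "eventually (\<lambda>n. e n < 1) sequentially"
        using e by (rule order_tendstoD) simp
      then show ?thesis
      proof eventually_elim
        case (elim n)
        have "0 \<le> e n" using that by (simp add: e_def)
        then have "f ((1 - e n) *\<^sub>R x + e n *\<^sub>R y n) \<le> (1 - e n) * f x + e n * f (y n)"
          using elim by (intro convex_onD[OF conv]) auto
        also have "\<dots> \<le> (1 - e n) * f x + e n * C"
          using y(1) \<open>0 \<le> e n\<close> by (simp add: mult_left_mono)
        finally show ?case .
      qed
    qed
    ultimately show ?thesis
      by (auto dest: tendsto_le[OF sequentially_bot, rotated])
  qed
  have "real_polynomial_function (f \<circ> (\<lambda>s. x + s *\<^sub>R u))"
    by (intro real_polynomial_function_compose pol polynomial_function_add polynomial_function_mult
        polynomial_function_const polynomial_function_id)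
  then have "(f \<circ> (\<lambda>s. x + s *\<^sub>R u)) t = (f \<circ> (\<lambda>s. x + s *\<^sub>R u)) 0"
  proof (rule real_polynomial_bounded_on_ray_const)
    fix s :: real assume "0 \<le> s"
    then show "\<bar>(f \<circ> (\<lambda>s. x + s *\<^sub>R u)) s\<bar> \<le> max \<bar>m\<bar> \<bar>f x\<bar>"
      using le[of s] lower[of "x + s *\<^sub>R u"] by (simp add: abs_if max_def)
  qed
  then show ?thesis by simp
qed

text \<open>If points of least norm in shrinking sublevel sets escaped to infinity, \<open>f\<close> would be
  constant along a limit direction \<open>u\<close> of theirs, so moving them along \<open>u\<close> would stay in the
  sublevel set while decreasing the norm.\<close>

lemma convex_polynomial_attains_inf:
  fixes f :: "'a::euclidean_space \<Rightarrow> real"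
  assumes pol: "real_polynomial_function f" and conv: "convex_on UNIV f"
    and lower: "\<And>x. m \<le> f x"
  shows "\<exists>z. \<forall>x. f z \<le> f x"
proof -
  have cont: "isCont f z" for z
    by (intro differentiable_imp_continuous_within differentiable_at_real_polynomial_function pol)
  define I where "I = (INF x. f x)"
  have I: "I \<le> f x" for x
    unfolding I_def using lower by (intro cINF_lower bdd_belowI2) auto
  define S where "S k = {x. f x \<le> I + 1 / real (Suc k)}" for k
  have "\<exists>y\<in>S k. \<forall>x\<in>S k. dist 0 y \<le> dist 0 x" for k
  proof -
    have "\<exists>x. f x < I + 1 / real (Suc k)"
      using cInf_lessD[of "range f" "I + 1 / real (Suc k)"] by (auto simp: I_def)
    then have "S k \<noteq> {}" by (auto simp: S_def intro: less_imp_le)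
    moreover have "closed (S k)"
      unfolding S_def using cont
      by (intro closed_Collect_le continuous_on_const) (simp add: continuous_at_imp_continuous_on)
    ultimately show ?thesis using distance_attains_inf by metis
  qed
  then obtain y where y: "\<And>k. y k \<in> S k" "\<And>k x. x \<in> S k \<Longrightarrow> norm (y k) \<le> norm x"
    by (metis dist_0_norm)
  show ?thesis
  proof (cases "bounded (range y)")
    case True
    then obtain l r where r: "strict_mono (r :: nat \<Rightarrow> nat)" "(y \<circ> r) \<longlonglongrightarrow> l"
      using bounded_imp_convergent_subsequence by blast
    have "(\<lambda>n. f (y (r n))) \<longlonglongrightarrow> f l"
      using isCont_tendsto_compose[OF cont r(2)] by (simp add: o_def)
    moreover have "(\<lambda>n. I + 1 / real (Suc (r n))) \<longlonglongrightarrow> I + 0"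
      using LIMSEQ_subseq_LIMSEQ[OF LIMSEQ_inverse_real_of_nat r(1)]
      by (intro tendsto_add tendsto_const) (simp add: o_def inverse_eq_divide)
    ultimately have "f l \<le> I + 0"
      by (rule LIMSEQ_le) (use y(1) in \<open>auto simp: S_def\<close>)
    then show ?thesis using I by (metis add.right_neutral order_trans)
  next
    case False
    then have "\<exists>k. real n < norm (y k)" for n
      unfolding bounded_iff by (auto simp: not_le[symmetric])
    then obtain k where k: "\<And>n. real n < norm (y (k n))" by metis
    define w where "w n = y (k n) /\<^sub>R norm (y (k n))" for n
    have "norm (w n) \<le> 1" for n
      by (cases "y (k n) = 0") (simp_all add: w_def)
    then have "bounded (range w)"
      unfolding bounded_iff by blast
    then obtain u r where r: "strict_mono (r :: nat \<Rightarrow> nat)" "(w \<circ> r) \<longlonglongrightarrow> u"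
      using bounded_imp_convergent_subsequence by blast
    define z where "z n = y (k (r n))" for n
    have pos: "0 < norm (z n)" for n
      unfolding z_def using k[of "r n"] by (meson le_less_trans of_nat_0_le_iff)
    have dir: "(\<lambda>n. z n /\<^sub>R norm (z n)) \<longlonglongrightarrow> u"
      using r(2) by (simp add: w_def z_def o_def)
    have "real n \<le> norm (z n)" for n
      using k[of "r n"] seq_suble[OF r(1), of n] by (simp add: z_def)
    then have lim: "filterlim (\<lambda>n. norm (z n)) at_top sequentially"
      by (intro filterlim_at_top_mono[OF filterlim_real_sequentially]) auto
    have bnd: "f (z n) \<le> I + 1" for n
    proof -
      have "f (z n) \<le> I + 1 / real (Suc (k (r n)))"
        using y(1) by (simp add: S_def z_def)
      also have "\<dots> \<le> I + 1" by (simp add: divide_le_eq)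
      finally show ?thesis .
    qed
    have const: "f (x + t *\<^sub>R u) = f x" for x t
      using convex_polynomial_constant_along_recession[OF pol conv lower bnd lim dir] .
    have le: "norm (z n) \<le> norm (z n + t *\<^sub>R u)" for n t
      using y(1)[of "k (r n)"] y(2)[of "z n + t *\<^sub>R u" "k (r n)"] const[of "z n" t]
      by (simp add: S_def z_def)
    have orth: "z n \<bullet> u = 0" for n
    proof -
      have "z n \<bullet> z n \<le> (z n + t *\<^sub>R u) \<bullet> (z n + t *\<^sub>R u)" for t
        using le[of n t] by (simp add: norm_le)
      then have *: "0 \<le> t * (2 * (z n \<bullet> u) + t * (u \<bullet> u))" for t
        by (simp add: inner_add_left inner_add_right inner_commute algebra_simps)
      show ?thesis
      proof (cases "u = 0")
        case False
        then have "0 < u \<bullet> u" by simp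
        \<comment> \<open>This \<open>t\<close> minimises the quadratic, whose value there is minus
          the square of \<open>z n \<bullet> u\<close> divided by
          \<open>u \<bullet> u\<close>.\<close>
        with *[of "- (z n \<bullet> u) / (u \<bullet> u)"] have "(z n \<bullet> u) * (z n \<bullet> u) \<le> 0"
          by (simp add: field_simps zero_le_divide_iff)
        then show ?thesis by (metis mult_eq_0_iff order_antisym zero_le_square)
      qed simp
    qed
    \<comment> \<open>Orthogonality survives in the limit of the unit directions and gives
      \<open>u \<bullet> u = 0\<close>, whereas a limit of unit vectors has norm
      \<open>1\<close>.\<close>
    have "(\<lambda>n. (z n /\<^sub>R norm (z n)) \<bullet> u) \<longlonglongrightarrow> u \<bullet> u"
      by (intro tendsto_intros dir)
    then have "u \<bullet> u = 0" using orth by (simp add: LIMSEQ_const_iff)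
    moreover have "(\<lambda>n. norm (z n /\<^sub>R norm (z n))) \<longlonglongrightarrow> norm u"
      by (intro tendsto_intros dir)
    then have "norm u = 1" using pos by (simp add: LIMSEQ_const_iff)
    ultimately show ?thesis by simp
  qed
qed

text \<open>At a minimiser \<open>z\<close> the derivative vanishes, so the Taylor remainder at
  \<open>z\<close> is \<open>f - f z\<close>; adding the nonnegative constant \<open>f z\<close>
  recovers \<open>f\<close>.\<close>

lemma nonneg_sos_taylor_remainders_imp_is_sos:
  fixes f :: "real ^ 'n \<Rightarrow> real"
  assumes "sos_taylor_remainders f" and "\<And>x. 0 \<le> f x"
  shows "is_sos f"
proof -
  have f: "real_polynomial_function f"
    using assms(1) by (simp add: sos_taylor_remainders_def)
  obtain z where z: "\<And>x. f z \<le> f x"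
    using convex_polynomial_attains_inf[OF f sos_taylor_remainders_imp_convex_on[OF assms(1)] assms(2)]
    by blast
  have "frechet_derivative f (at z) = (\<lambda>h. 0)"
    using z by (intro has_derivative_local_min[OF real_polynomial_function_has_derivative[OF f]]) auto
  moreover have "is_sos (\<lambda>x. f x - f z - frechet_derivative f (at z) (x - z))"
    using assms(1) by (simp add: sos_taylor_remainders_def)
  ultimately have "is_sos (\<lambda>x. f x - f z)" by simp
  from is_sos_add[OF this is_sos_const[OF assms(2)[of z]]] show ?thesis by simp
qed

section \<open>Lagrange multipliers by separation\<close>

text \<open>A theorem of the alternative. The origin is separated from the set of pairs strictly
  above the values at some point; upward rays in that set force nonnegative multipliers, and the
  Slater point excludes \<open>\<delta> = 0\<close>, so that \<open>\<delta>\<close> can be scaled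
  to sum \<open>1\<close>.\<close>

lemma convex_system_multipliers:
  fixes h :: "'r::finite \<Rightarrow> 'a::real_vector \<Rightarrow> real" and g :: "'m::finite \<Rightarrow> 'a \<Rightarrow> real"
  assumes h: "\<And>j. convex_on UNIV (h j)" and g: "\<And>i. convex_on UNIV (g i)"
    and infeasible: "\<And>x. (\<forall>i. g i x < 0) \<Longrightarrow> \<exists>j. 0 \<le> h j x"
    and slater: "\<forall>i. g i x\<^sub>0 < 0"
  obtains \<delta> :: "real ^ 'r" and l :: "real ^ 'm"
  where "\<delta> \<in> simplex_weights" and "\<And>i. 0 \<le> l $ i"
    and "\<And>x. 0 \<le> (\<Sum>j\<in>UNIV. \<delta> $ j * h j x) + (\<Sum>i\<in>UNIV. l $ i * g i x)"
proof -
  \<comment> \<open>Strict inequalities make \<open>0 \<notin> K\<close> the same as infeasibility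
    of the strict system.\<close>
  define K where "K = {(y :: real ^ 'r, z :: real ^ 'm). \<exists>x. (\<forall>j. h j x < y $ j) \<and> (\<forall>i. g i x < z $ i)}"
  have comb: "f ((1 - u) *\<^sub>R x + u *\<^sub>R x') < (1 - u) * c + u * c'"
    if "convex_on UNIV f" "f x < c" "f x' < c'" "0 < u" "u < 1" for f :: "'a \<Rightarrow> real" and u x x' c c'
  proof -
    have "f ((1 - u) *\<^sub>R x + u *\<^sub>R x') \<le> (1 - u) * f x + u * f x'"
      using that by (intro convex_onD) auto
    also have "\<dots> < (1 - u) * c + u * c'"
      using that by (intro add_strict_mono mult_strict_left_mono) auto
    finally show ?thesis .
  qed
  have "convex K"
    unfolding convex_alt
  proof (intro ballI allI impI)
    fix a b and u :: real
    assume ab: "a \<in> K" "b \<in> K" and u: "0 \<le> u \<and> u \<le> 1"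
    obtain x where x: "\<forall>j. h j x < fst a $ j" "\<forall>i. g i x < snd a $ i"
      using ab(1) by (auto simp: K_def)
    obtain x' where x': "\<forall>j. h j x' < fst b $ j" "\<forall>i. g i x' < snd b $ i"
      using ab(2) by (auto simp: K_def)
    show "(1 - u) *\<^sub>R a + u *\<^sub>R b \<in> K"
    \<comment> \<open>At the ends one weight is \<open>0\<close>, so \<open>comb\<close>, which asks
      for two positive weights, does not apply; there the point is \<open>a\<close> or
      \<open>b\<close> itself.\<close>
    proof (cases "u = 0 \<or> u = 1")
      case True
      then show ?thesis using ab by auto
    next
      case False
      then have "0 < u" "u < 1" using u by auto
      then have "(\<forall>j. h j ((1 - u) *\<^sub>R x + u *\<^sub>R x') < fst ((1 - u) *\<^sub>R a + u *\<^sub>R b) $ j) \<and>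
          (\<forall>i. g i ((1 - u) *\<^sub>R x + u *\<^sub>R x') < snd ((1 - u) *\<^sub>R a + u *\<^sub>R b) $ i)"
        using x x' by (auto intro!: comb h g)
      then show ?thesis unfolding K_def case_prod_unfold by blast
    qed
  qed
  moreover have "0 \<notin> K"
    using infeasible by (force simp: K_def zero_prod_def not_le[symmetric])
  ultimately obtain a where a: "a \<noteq> 0" "\<forall>w\<in>K. 0 \<le> a \<bullet> w"
    using separating_hyperplane_set_0 by blast
  define \<delta> where "\<delta> = fst a"
  define l where "l = snd a"
  have sep: "0 \<le> (\<Sum>j\<in>UNIV. \<delta> $ j * y j) + (\<Sum>i\<in>UNIV. l $ i * z i)"
    if "\<And>j. h j x < y j" "\<And>i. g i x < z i" for x y z
  proof -
    have "((\<chi> j. y j), (\<chi> i. z i)) \<in> K"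
      using that by (auto simp: K_def)
    then have "0 \<le> a \<bullet> ((\<chi> j. y j), (\<chi> i. z i))" using a(2) by blast
    then show ?thesis
      by (simp add: \<delta>_def l_def inner_prod_def inner_vec_def)
  qed
  \<comment> \<open>Prepared for raising one coordinate of a pair in \<open>K\<close> by an
    arbitrary \<open>t\<close>: a negative multiplier would eventually make the separating
    functional negative.\<close>
  have ray: "0 \<le> c" if "\<And>t. 0 \<le> t \<Longrightarrow> 0 \<le> b + t * c" for b c :: real
  proof (rule ccontr)
    assume "\<not> 0 \<le> c"
    then have "0 \<le> (\<bar>b\<bar> + 1) / - c" by (intro divide_nonneg_nonneg) auto
    moreover have "(\<bar>b\<bar> + 1) / - c * c = - (\<bar>b\<bar> + 1)" using \<open>\<not> 0 \<le> c\<close> by auto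
    ultimately show False using that[of "(\<bar>b\<bar> + 1) / - c"] by linarith
  qed
  have \<delta>: "0 \<le> \<delta> $ k" for k
  proof (rule ray)
    fix t :: real assume "0 \<le> t"
    then have "0 \<le> (\<Sum>j\<in>UNIV. \<delta> $ j * (h j x\<^sub>0 + 1 + (if j = k then t else 0))) + (\<Sum>i\<in>UNIV. l $ i * (g i x\<^sub>0 + 1))"
      by (intro sep[of x\<^sub>0]) auto
    also have "\<dots> = ((\<Sum>j\<in>UNIV. \<delta> $ j * (h j x\<^sub>0 + 1)) + (\<Sum>i\<in>UNIV. l $ i * (g i x\<^sub>0 + 1))) + t * \<delta> $ k"
      by (simp add: distrib_left sum.distrib if_distrib[of "\<lambda>c. _ * c"] cong: if_cong)
    finally show "0 \<le> \<dots>" .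
  qed
  have l: "0 \<le> l $ k" for k
  proof (rule ray)
    fix t :: real assume "0 \<le> t"
    then have "0 \<le> (\<Sum>j\<in>UNIV. \<delta> $ j * (h j x\<^sub>0 + 1)) + (\<Sum>i\<in>UNIV. l $ i * (g i x\<^sub>0 + 1 + (if i = k then t else 0)))"
      by (intro sep[of x\<^sub>0]) auto
    also have "\<dots> = ((\<Sum>j\<in>UNIV. \<delta> $ j * (h j x\<^sub>0 + 1)) + (\<Sum>i\<in>UNIV. l $ i * (g i x\<^sub>0 + 1))) + t * l $ k"
      by (simp add: distrib_left sum.distrib if_distrib[of "\<lambda>c. _ * c"] cong: if_cong)
    finally show "0 \<le> \<dots>" .
  qed
  \<comment> \<open>The values themselves do not satisfy the strict inequalities in
    \<open>sep\<close>, so they are raised by \<open>\<epsilon>\<close>, at a cost of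
    \<open>T * \<epsilon> \<le> e\<close>. The \<open>+ 1\<close> in \<open>\<epsilon>\<close> keeps
    the denominator positive.\<close>
  have nonneg: "0 \<le> (\<Sum>j\<in>UNIV. \<delta> $ j * h j x) + (\<Sum>i\<in>UNIV. l $ i * g i x)" for x
  proof (rule field_le_epsilon)
    fix e :: real assume "0 < e"
    define T where "T = (\<Sum>j\<in>UNIV. \<delta> $ j) + (\<Sum>i\<in>UNIV. l $ i)"
    have T: "0 \<le> T" unfolding T_def using \<delta> l by (intro add_nonneg_nonneg sum_nonneg)
    define \<epsilon> where "\<epsilon> = e / (T + 1)"
    have "0 < \<epsilon>" using \<open>0 < e\<close> T by (simp add: \<epsilon>_def)
    then have "0 \<le> (\<Sum>j\<in>UNIV. \<delta> $ j * (h j x + \<epsilon>)) + (\<Sum>i\<in>UNIV. l $ i * (g i x + \<epsilon>))"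
      by (intro sep[of x]) auto
    also have "\<dots> = (\<Sum>j\<in>UNIV. \<delta> $ j * h j x) + (\<Sum>i\<in>UNIV. l $ i * g i x) + T * \<epsilon>"
      by (simp add: T_def distrib_left distrib_right sum.distrib sum_distrib_right)
    also have "T * \<epsilon> \<le> e"
      using T \<open>0 < e\<close> by (simp add: \<epsilon>_def field_simps)
    finally show "0 \<le> (\<Sum>j\<in>UNIV. \<delta> $ j * h j x) + (\<Sum>i\<in>UNIV. l $ i * g i x) + e" by simp
  qed
  define s where "s = (\<Sum>j\<in>UNIV. \<delta> $ j)"
  \<comment> \<open>With \<open>\<delta> = 0\<close> some entry of \<open>l\<close> would be
    positive, and the combination at the Slater point would be negative.\<close>
  have "0 < s"
  proof (rule ccontr)
    assume "\<not> 0 < s"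
    then have "s = 0" unfolding s_def using \<delta> sum_nonneg[of UNIV "\<lambda>j. \<delta> $ j"] by simp
    then have \<delta>0: "\<delta> $ j = 0" for j
      unfolding s_def using \<delta> by (simp add: sum_nonneg_eq_0_iff)
    then have "\<delta> = 0" by (simp add: vec_eq_iff)
    then have "l \<noteq> 0" using a(1) by (simp add: \<delta>_def l_def prod_eq_iff)
    then obtain k where "l $ k \<noteq> 0" by (auto simp: vec_eq_iff)
    then have "0 < l $ k" using l[of k] by simp
    have "(\<Sum>i\<in>UNIV. l $ i * g i x\<^sub>0) < (\<Sum>i\<in>(UNIV::'m set). 0)"
    proof (rule sum_strict_mono_ex1)
      show "\<forall>i\<in>UNIV. l $ i * g i x\<^sub>0 \<le> 0"
        using l slater by (auto intro: mult_nonneg_nonpos less_imp_le)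
      show "\<exists>i\<in>UNIV. l $ i * g i x\<^sub>0 < 0"
        using \<open>0 < l $ k\<close> slater by (auto intro: mult_pos_neg)
    qed simp
    then show False using nonneg[of x\<^sub>0] \<delta>0 by simp
  qed
  show thesis
  proof (rule that[of "(1 / s) *\<^sub>R \<delta>" "(1 / s) *\<^sub>R l"])
    show "(1 / s) *\<^sub>R \<delta> \<in> simplex_weights"
      using \<delta> \<open>0 < s\<close>
      by (simp add: simplex_weights_def s_def[symmetric] sum_divide_distrib[symmetric])
    show "0 \<le> ((1 / s) *\<^sub>R l) $ i" for i
      using l \<open>0 < s\<close> by simp
    show "0 \<le> (\<Sum>j\<in>UNIV. ((1 / s) *\<^sub>R \<delta>) $ j * h j x) + (\<Sum>i\<in>UNIV. ((1 / s) *\<^sub>R l) $ i * g i x)" for x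
    proof -
      have "(\<Sum>j\<in>UNIV. ((1 / s) *\<^sub>R \<delta>) $ j * h j x) + (\<Sum>i\<in>UNIV. ((1 / s) *\<^sub>R l) $ i * g i x) =
          (1 / s) * ((\<Sum>j\<in>UNIV. \<delta> $ j * h j x) + (\<Sum>i\<in>UNIV. l $ i * g i x))"
        unfolding distrib_left sum_distrib_left by simp
      then show ?thesis using nonneg[of x] \<open>0 < s\<close> by simp
    qed
  qed
qed

section \<open>Degree bounds and weak duality\<close>

lemma poly_degree_le_cmult: "poly_degree_le k f \<Longrightarrow> poly_degree_le k (\<lambda>x. c * f x)"
  using poly_degree_le_mult[OF poly_degree_le_const] by simp

lemma poly_degree_le_sum:
  assumes "finite A" and "\<And>a. a \<in> A \<Longrightarrow> poly_degree_le k (f a)"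
  shows "poly_degree_le k (\<lambda>x. \<Sum>a\<in>A. f a x)"
  using assms
proof (induction A rule: finite_induct)
  case empty
  then show ?case using poly_degree_le_mono[OF poly_degree_le_const] by simp
qed (simp add: poly_degree_le_add)

lemma poly_degree_le_of_poly_degree:
  assumes "real_polynomial_function f" and "poly_degree f \<le> k"
  shows "poly_degree_le k f"
proof -
  have "poly_degree_le (poly_degree f) f"
    using assms(1) unfolding poly_degree_def real_polynomial_function_iff_degree_le by (rule LeastI_ex)
  then show ?thesis using assms(2) by (rule poly_degree_le_mono)
qed

lemma poly_degree_le_imp: "poly_degree_le k f \<Longrightarrow> poly_degree f \<le> k"
  unfolding poly_degree_def by (rule Least_le)

lemma even_degree_bound_ge:
  shows "poly_degree q \<le> even_degree_bound p g q"
    and "poly_degree (p j) \<le> even_degree_bound p g q"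
    and "poly_degree (g i) \<le> even_degree_bound p g q"
proof -
  let ?D = "{poly_degree q} \<union> range (\<lambda>j. poly_degree (p j)) \<union> range (\<lambda>i. poly_degree (g i))"
  \<comment> \<open>Twice the maximum is an even upper bound, so the least one exists.\<close>
  have "even (2 * k) \<and> k \<le> 2 * k" for k :: nat by simp
  from this[of "Max ?D"] have "even (even_degree_bound p g q) \<and> Max ?D \<le> even_degree_bound p g q"
    unfolding even_degree_bound_def by (rule LeastI)
  then have *: "Max ?D \<le> even_degree_bound p g q" ..
  show "poly_degree q \<le> even_degree_bound p g q"
    by (rule order_trans[OF Max_ge *]) auto
  show "poly_degree (p j) \<le> even_degree_bound p g q"
    by (rule order_trans[OF Max_ge *]) auto
  show "poly_degree (g i) \<le> even_degree_bound p g q"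
    by (rule order_trans[OF Max_ge *]) auto
qed

text \<open>Weak duality: at a feasible \<open>x\<close> the sum of squares is nonnegative and the
  constraint terms are nonpositive, while the weighted numerators add up to at most the largest
  ratio times \<open>q x\<close>. Dividing by \<open>q x\<close> leaves the bound on
  \<open>\<mu>\<close>.\<close>

lemma dual_feasible_value_le:
  fixes p :: "'r::finite \<Rightarrow> real ^ 'n \<Rightarrow> real" and g :: "'m::finite \<Rightarrow> real ^ 'n \<Rightarrow> real"
  assumes "\<mu> \<in> dual_feasible_values p g q" and x: "x \<in> feasible_set g" and q: "0 < q x"
  shows "\<mu> \<le> Max (range (\<lambda>j. p j x / q x))"
proof -
  obtain \<delta> :: "real ^ 'r" and l :: "real ^ 'm" where \<delta>: "\<delta> \<in> simplex_weights" and l: "\<forall>i. 0 \<le> l $ i"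
    and sos: "(\<lambda>x. (\<Sum>j\<in>UNIV. \<delta> $ j * p j x) + (\<Sum>i\<in>UNIV. l $ i * g i x) - \<mu> * q x)
        \<in> Sigma2 (even_degree_bound p g q)"
    using assms(1) unfolding dual_feasible_values_def by blast
  let ?M = "Max (range (\<lambda>j. p j x / q x))"
  have "0 \<le> (\<Sum>j\<in>UNIV. \<delta> $ j * p j x) + (\<Sum>i\<in>UNIV. l $ i * g i x) - \<mu> * q x"
    using sos is_sos_nonneg unfolding Sigma2_def by blast
  moreover have "(\<Sum>i\<in>UNIV. l $ i * g i x) \<le> 0"
    using l x by (intro sum_nonpos mult_nonneg_nonpos) (auto simp: feasible_set_def)
  moreover have "(\<Sum>j\<in>UNIV. \<delta> $ j * p j x) \<le> (\<Sum>j\<in>UNIV. \<delta> $ j * (?M * q x))"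
  proof (intro sum_mono mult_left_mono)
    fix j
    have "p j x / q x \<le> ?M" by (rule Max_ge) auto
    then show "p j x \<le> ?M * q x" using q by (simp add: divide_le_eq)
    show "0 \<le> \<delta> $ j" using \<delta> by (simp add: simplex_weights_def)
  qed
  moreover have "(\<Sum>j\<in>UNIV. \<delta> $ j * (?M * q x)) = ?M * q x"
    using \<delta> by (simp add: simplex_weights_def sum_distrib_right[symmetric])
  ultimately have "\<mu> * q x \<le> ?M * q x" by linarith
  then show ?thesis using q by simp
qed

section \<open>Strong duality with dual attainment\<close>

theorem theorem4p3:
  fixes p :: "'r::finite \<Rightarrow> real ^ 'n \<Rightarrow> real"
    and g :: "'m::finite \<Rightarrow> real ^ 'n \<Rightarrow> real"
    and q :: "real ^ 'n \<Rightarrow> real"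
  assumes "\<And>j. real_polynomial_function (p j)"
    and "\<And>i. real_polynomial_function (g i)"
    and "real_polynomial_function q"
    and "\<And>j. sos_convex (p j)"
    and "\<And>i. sos_convex (g i)"
    and "sos_convex (\<lambda>x. - q x)"
    and "feasible_set g \<noteq> {}"
    and "\<And>x j. x \<in> feasible_set g \<Longrightarrow> p j x \<ge> 0"
    and "\<And>x. x \<in> feasible_set g \<Longrightarrow> q x > 0"
    and slater: "{x. \<forall>i. g i x < 0} \<noteq> {}"
  shows "primal_value p g q = dual_value p g q \<and>
         (\<exists>\<mu> \<in> dual_feasible_values p g q. ereal \<mu> = dual_value p g q)"
proof -
  note pol = assms(1-3) and conv = assms(4-6)[THEN sos_convex_imp_sos_taylor_remainders]
  note ne = assms(7) and p_nonneg = assms(8) and q_pos = assms(9)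
  let ?F = "feasible_set g"
  define M where "M x = Max (range (\<lambda>j. p j x / q x))" for x
  have M_nonneg: "0 \<le> M x" if "x \<in> ?F" for x
  proof -
    \<comment> \<open>Types are nonempty, so \<open>undefined\<close> serves as some index; any
      single ratio bounds the maximum from below.\<close>
    have "0 \<le> p undefined x / q x"
      using p_nonneg q_pos that by (simp add: less_imp_le)
    also have "\<dots> \<le> M x" unfolding M_def by (rule Max_ge) auto
    finally show ?thesis .
  qed
  \<comment> \<open>A real infimum; nonnegativity of \<open>M\<close> on the nonempty set
    \<open>?F\<close> makes it agree with the extended-real primal value.\<close>
  define V where "V = Inf (M ` ?F)"
  have bdd: "bdd_below (M ` ?F)" using M_nonneg by (rule bdd_belowI2)
  have V_le: "V \<le> M x" if "x \<in> ?F" for x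
    unfolding V_def using bdd that by (intro cINF_lower)
  have "0 \<le> V"
    unfolding V_def using ne M_nonneg by (intro cINF_greatest)
  have primal: "primal_value p g q = ereal V"
    using ereal_Inf'[OF bdd] ne by (simp add: primal_value_def V_def M_def image_comp o_def)
  \<comment> \<open>The form \<open>V * - q x\<close> with \<open>V \<ge> 0\<close> brings in the
    assumption on \<open>- q\<close>, as a nonnegative multiple inside a sum.\<close>
  define h where "h j x = p j x + V * - q x" for j x
  have h: "sos_taylor_remainders (h j)" for j
    unfolding h_def[abs_def] using conv \<open>0 \<le> V\<close>
    by (intro sos_taylor_remainders_add sos_taylor_remainders_cmult)
  \<comment> \<open>The index attaining the maximum at a strictly feasible \<open>x\<close> has
    ratio at least \<open>V\<close>; multiplying by \<open>q x > 0\<close> makes its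
    \<open>h j x\<close> nonnegative.\<close>
  have active: "\<exists>j. 0 \<le> h j x" if "\<forall>i. g i x < 0" for x
  proof -
    have x: "x \<in> ?F" using that by (simp add: feasible_set_def less_imp_le)
    have "M x \<in> range (\<lambda>j. p j x / q x)" unfolding M_def by (rule Max_in) auto
    then obtain j where "M x = p j x / q x" by blast
    then have "V \<le> p j x / q x" using V_le[OF x] by simp
    then have "0 \<le> h j x" using q_pos[OF x] by (simp add: h_def le_divide_eq)
    then show ?thesis ..
  qed
  obtain x\<^sub>0 where "\<forall>i. g i x\<^sub>0 < 0" using slater by blast
  then obtain \<delta> :: "real ^ 'r" and l :: "real ^ 'm"
    where \<delta>: "\<delta> \<in> simplex_weights" and l: "\<And>i. 0 \<le> l $ i"
      and nonneg: "\<And>x. 0 \<le> (\<Sum>j\<in>UNIV. \<delta> $ j * h j x) + (\<Sum>i\<in>UNIV. l $ i * g i x)"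
    using convex_system_multipliers[where h = h and g = g, OF _ _ active]
      sos_taylor_remainders_imp_convex_on[OF h] sos_taylor_remainders_imp_convex_on[OF conv(2)]
    by metis
  let ?L = "\<lambda>x. (\<Sum>j\<in>UNIV. \<delta> $ j * p j x) + (\<Sum>i\<in>UNIV. l $ i * g i x) - V * q x"
  have L: "(\<Sum>j\<in>UNIV. \<delta> $ j * h j x) + (\<Sum>i\<in>UNIV. l $ i * g i x) = ?L x" for x
  proof -
    have "(\<Sum>j\<in>UNIV. \<delta> $ j * h j x) = (\<Sum>j\<in>UNIV. \<delta> $ j * p j x) - (\<Sum>j\<in>UNIV. \<delta> $ j) * (V * q x)"
      unfolding h_def by (simp add: algebra_simps sum_subtractf sum_distrib_left)
    then show ?thesis using \<delta> by (simp add: simplex_weights_def)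
  qed
  have "sos_taylor_remainders (\<lambda>x. (\<Sum>j\<in>UNIV. \<delta> $ j * h j x) + (\<Sum>i\<in>UNIV. l $ i * g i x))"
    using \<delta> l h conv(2)
    by (intro sos_taylor_remainders_add sos_taylor_remainders_sum sos_taylor_remainders_cmult finite)
       (simp_all add: simplex_weights_def)
  then have "is_sos ?L"
    unfolding L using nonneg unfolding L by (rule nonneg_sos_taylor_remainders_imp_is_sos)
  moreover have "poly_degree_le (even_degree_bound p g q) ?L"
  proof -
    let ?d = "even_degree_bound p g q"
    have "poly_degree_le ?d (\<lambda>x. (\<Sum>j\<in>UNIV. \<delta> $ j * p j x) + (\<Sum>i\<in>UNIV. l $ i * g i x) + - V * q x)"
      by (intro poly_degree_le_add poly_degree_le_sum finite poly_degree_le_cmult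
          poly_degree_le_of_poly_degree pol even_degree_bound_ge)
    then show ?thesis by simp
  qed
  ultimately have "?L \<in> Sigma2 (even_degree_bound p g q)"
    by (simp add: Sigma2_def poly_degree_le_imp)
  then have feasible: "V \<in> dual_feasible_values p g q"
    unfolding dual_feasible_values_def using \<delta> l by blast
  \<comment> \<open>Weak duality at every feasible point bounds \<open>\<mu>\<close> by the infimum;
    since \<open>V\<close> is itself dual feasible, the supremum is attained there.\<close>
  have "\<mu> \<le> V" if "\<mu> \<in> dual_feasible_values p g q" for \<mu>
    unfolding V_def M_def using ne dual_feasible_value_le[OF that] q_pos by (intro cINF_greatest) auto
  then have "dual_value p g q = ereal V"
    unfolding dual_value_def using feasible by (intro SUP_eqI) auto
  then show ?thesis using primal feasible by auto
qed

end
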